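(* Let $p$ be a prime with $p>48$, let $N$ be a multiple of $p^2$, and let $F:\mathbb{B}\to(\mathbb{Z}/p\mathbb{Z})^\times$ be an $\mathcal{S}_{p,N}$-Sudoku solution. Then there exist integers $A,B,C$, not all divisible by $p$, such that $F(n,m)=\pi_p(An+Bm+C)$ whenever $(n,m)\in\mathbb{B}$ satisfies $\nu_p(An+Bm+C)=0$. Furthermore, the coefficients $A,B,C$ are uniquely determined modulo $p$ (any two such triples, each not all divisible by $p$, agree modulo $p$), and $F$ has non-constant columns if and only if $p\nmid B$.
   Context: $\pi_p:\mathbb{Z}\to\mathbb{Z}/p\mathbb{Z}$ is reduction mod $p$, $(\mathbb{Z}/p\mathbb{Z})^\times=(\mathbb{Z}/p\mathbb{Z})\setminus\{0\}$, $\nu_p$ is the $p$-adic valuation with $\nu_p(0)=+\infty$. Define $f_p(n)=\pi_p(n/p^{\nu_p(n)})$ for $n\ne0$ and $f_p(0)=1\bmod p$. The Sudoku board is $\mathbb{B}=\{0,\dots,N-1\}\times\mathbb{Z}$. The Sudoku rule $\mathcal{S}_{p,N}$ is the set of functions $g:\{0,\dots,N-1\}\to(\mathbb{Z}/p\mathbb{Z})^\times$ for which there exist integers $a,b$, not both divisible by $p$, such that $g(n)=f_p(an+b)$ for all $n\in\{0,\dots,N-1\}$ with $\nu_p(an+b)\le1$. An $\mathcal{S}_{p,N}$-Sudoku solution is $F:\mathbb{B}\to(\mathbb{Z}/p\mathbb{Z})^\times$ such that for all $j,i\in\mathbb{Z}$ the function $n\mapsto F(n,jn+i)$ lies in $\mathcal{S}_{p,N}$.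 $F$ has non-constant columns if for every $n\in\{0,\dots,N-1\}$, $m\mapsto F(n,m)$ is non-constant. *)

theory Defs
  imports "HOL-Number_Theory.Residues" "HOL-Library.Extended_Nat"
begin

text \<open>
  The ring of residues modulo \<open>p\<close> is the library's \<^const>\<open>residue_ring\<close>, whose carrier consists of
  the canonical representatives \<open>0, \<dots>, p - 1\<close>; accordingly reduction modulo \<open>p\<close> is \<open>mod\<close>.
\<close>

definition reduction :: "int \<Rightarrow> int \<Rightarrow> int" where
  "reduction p n = n mod p"

definition nonzero_residues :: "int \<Rightarrow> int set" where
  "nonzero_residues p = carrier (residue_ring p) - {\<zero>\<^bsub>residue_ring p\<^esub>}"

text \<open>The library sets \<open>multiplicity p 0 = 0\<close>, whereas the valuation of zero is infinite.\<close>

definition valuation :: "int \<Rightarrow> int \<Rightarrow> enat" where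
  "valuation p n = (if n = 0 then \<infinity> else enat (multiplicity p n))"

definition last_digit :: "int \<Rightarrow> int \<Rightarrow> int" where
  "last_digit p n = (if n = 0 then reduction p 1 else reduction p (n div p ^ multiplicity p n))"

definition board :: "int \<Rightarrow> (int \<times> int) set" where
  "board N = {0..<N} \<times> UNIV"

text \<open>
  Functions on \<open>{0..<N}\<close> or on the board are total functions whose values elsewhere are
  unconstrained and never inspected.
\<close>

definition sudoku_rule :: "int \<Rightarrow> int \<Rightarrow> (int \<Rightarrow> int) set" where
  "sudoku_rule p N =
    {g \<in> {0..<N} \<rightarrow> nonzero_residues p.
      \<exists>a b. \<not> (p dvd a \<and> p dvd b) \<and>
        (\<forall>n\<in>{0..<N}. valuation p (a * n + b) \<le> 1 \<longrightarrow> g n = last_digit p (a * n + b))}"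

definition sudoku_solution :: "int \<Rightarrow> int \<Rightarrow> (int \<times> int \<Rightarrow> int) \<Rightarrow> bool" where
  "sudoku_solution p N F \<longleftrightarrow>
    F \<in> board N \<rightarrow> nonzero_residues p \<and>
    (\<forall>j i. (\<lambda>n. F (n, j * n + i)) \<in> sudoku_rule p N)"

definition nonconstant_columns :: "int \<Rightarrow> (int \<times> int \<Rightarrow> int) \<Rightarrow> bool" where
  "nonconstant_columns N F \<longleftrightarrow> (\<forall>n\<in>{0..<N}. \<not> (\<exists>c. \<forall>m. F (n, m) = c))"

definition affine_description ::
    "int \<Rightarrow> int \<Rightarrow> (int \<times> int \<Rightarrow> int) \<Rightarrow> int \<Rightarrow> int \<Rightarrow> int \<Rightarrow> bool" where
  "affine_description p N F A B C \<longleftrightarrow>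
    \<not> (p dvd A \<and> p dvd B \<and> p dvd C) \<and>
    (\<forall>(n, m)\<in>board N. valuation p (A * n + B * m + C) = 0 \<longrightarrow>
      F (n, m) = reduction p (A * n + B * m + C))"

end

theory Submission imports Defs begin

text \<open>
  On the line of slope \<open>j\<close> and intercept \<open>i\<close> the rule provides an affine form that vanishes
  modulo \<open>p\<close> at no more than one of any \<open>p\<close> consecutive abscissae. Counting over a long window,
  some position of a pattern of 21 incidences of points with lines of slope \<open>0\<close>, \<open>1\<close>, \<open>-1\<close> has
  no vanishing incidence, and the linear relations of the pattern then force the forms of four
  consecutive rows to be the restrictions of one form \<open>L = An + Bm + C\<close>. Call a point bad if
  \<open>L\<close> does not vanish there and differs from \<open>F\<close>. A line with a bad point has a bad point among
  any four consecutive ones; spreading a bad point first along its row and then along a diagonal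
  shows that four consecutive rows without bad points have neighbouring rows without bad points.
\<close>

section \<open>Zeros of affine forms modulo a prime\<close>

text \<open>Subtracting the two values leaves \<open>a * (x - y)\<close>. If \<open>p\<close>
  divides \<open>a\<close>, it divides \<open>b\<close> as well, which is excluded; otherwise it
  divides \<open>x - y\<close>, which is too small unless zero.\<close>

lemma affine_zero_unique:
  fixes p a b x y :: int
  assumes "prime p" "\<not> (p dvd a \<and> p dvd b)"
    and "p dvd a * x + b" "p dvd a * y + b" "\<bar>x - y\<bar> < p"
  shows "x = y"
proof -
  have "p dvd (a * x + b) - (a * y + b)"
    using assms(3,4) by (rule dvd_diff)
  then have "p dvd a * (x - y)"
    by (simp add: algebra_simps)
  then consider "p dvd a" | "p dvd x - y"
    using assms(1) prime_dvd_mult_iff by blast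
  then show ?thesis
  proof cases
    case 1
    then have "p dvd b"
      using assms(3) by (meson dvd_add_right_iff dvd_mult2)
    with 1 assms(2) show ?thesis by blast
  next
    case 2
    show ?thesis
    proof (rule ccontr)
      assume "x \<noteq> y"
      with 2 have "\<bar>p\<bar> \<le> \<bar>x - y\<bar>"
        by (intro dvd_imp_le_int) auto
      with assms(5) show False by linarith
    qed
  qed
qed

lemma affine_agree_everywhere:
  fixes p a b c d x :: int
  assumes "prime p" "p dvd (a * x + b) - (c * x + d)"
    and "p dvd (a * (x + 1) + b) - (c * (x + 1) + d)"
  shows "p dvd (a * n + b) - (c * n + d)"
proof -
  have "p dvd a - c \<and> p dvd b - d"
  proof (rule ccontr)
    assume *: "\<not> (p dvd a - c \<and> p dvd b - d)"
    have "x = x + 1"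
      by (rule affine_zero_unique[OF assms(1) *])
        (use assms prime_gt_1_int[OF assms(1)] in \<open>simp_all add: algebra_simps\<close>)
    then show False by simp
  qed
  then have "p dvd (a - c) * n + (b - d)"
    by simp
  then show ?thesis
    by (simp add: algebra_simps)
qed

text \<open>As \<open>p > 3\<close>, each form vanishes at no more than one of four consecutive
  integers, so three forms cannot cover all four.\<close>

lemma three_affine_forms_nonzero:
  fixes p s :: int
  assumes p: "prime p" "p > 3"
    and "\<not> (p dvd a1 \<and> p dvd b1)" "\<not> (p dvd a2 \<and> p dvd b2)" "\<not> (p dvd a3 \<and> p dvd b3)"
  shows "\<exists>n\<in>{s..s + 3}. \<not> p dvd a1 * n + b1 \<and> \<not> p dvd a2 * n + b2 \<and> \<not> p dvd a3 * n + b3"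
proof (rule ccontr)
  assume H: "\<not> ?thesis"
  define Z where "Z a b = {n \<in> {s..s + 3}. p dvd a * n + b}" for a b :: int
  have card: "card (Z a b) \<le> 1" if "\<not> (p dvd a \<and> p dvd b)" for a b
  proof (rule card_le_Suc0_iff_eq[THEN iffD2, unfolded One_nat_def[symmetric]])
    show "finite (Z a b)"
      unfolding Z_def by (rule finite_subset[of _ "{s..s + 3}"]) auto
    show "\<forall>x\<in>Z a b. \<forall>y\<in>Z a b. x = y"
    proof (intro ballI)
      fix x y assume "x \<in> Z a b" "y \<in> Z a b"
      then show "x = y"
        using p(2) unfolding Z_def by (intro affine_zero_unique[OF p(1) that]) auto
    qed
  qed
  have "{s..s + 3} = Z a1 b1 \<union> Z a2 b2 \<union> Z a3 b3"
    using H unfolding Z_def by blast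
  moreover have "card {s..s + 3} = 4"
    by simp
  ultimately have "4 = card (Z a1 b1 \<union> Z a2 b2 \<union> Z a3 b3)"
    by metis
  also have "\<dots> \<le> card (Z a1 b1) + card (Z a2 b2) + card (Z a3 b3)"
    by (meson add_le_mono1 card_Un_le le_trans)
  also have "\<dots> \<le> 3"
    using card[OF assms(3)] card[OF assms(4)] card[OF assms(5)] by linarith
  finally show False by simp
qed

section \<open>Affine forms attached to lines\<close>

text \<open>The rule at points of valuation 0, where \<open>last_digit\<close> is plain reduction. A
  congruence replaces the equality, so that no canonical representatives have to be tracked.\<close>

definition describes :: "int \<Rightarrow> int \<Rightarrow> (int \<Rightarrow> int) \<Rightarrow> int \<Rightarrow> int \<Rightarrow> bool" where
  "describes p N g a b \<longleftrightarrow> \<not> (p dvd a \<and> p dvd b) \<and>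
    (\<forall>n\<in>{0..<N}. \<not> p dvd a * n + b \<longrightarrow> [g n = a * n + b] (mod p))"

lemma sudoku_rule_describes:
  assumes "prime p" "g \<in> sudoku_rule p N"
  shows "\<exists>a b. describes p N g a b"
proof -
  obtain a b where ab: "\<not> (p dvd a \<and> p dvd b)"
    "\<And>n. n \<in> {0..<N} \<Longrightarrow> valuation p (a * n + b) \<le> 1 \<Longrightarrow> g n = last_digit p (a * n + b)"
    using assms(2) unfolding sudoku_rule_def by blast
  have "[g n = a * n + b] (mod p)" if "n \<in> {0..<N}" "\<not> p dvd a * n + b" for n
  proof -
    have mult: "multiplicity p (a * n + b) = 0" and "a * n + b \<noteq> 0"
      using that(2) by (auto simp: not_dvd_imp_multiplicity_0)
    then show ?thesis
      using ab(2)[OF that(1)]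
      by (simp add: valuation_def last_digit_def reduction_def cong_def zero_enat_def[symmetric])
  qed
  with ab(1) show ?thesis
    unfolding describes_def by blast
qed

text \<open>The form describing \<open>g\<close> differs modulo \<open>p\<close> from the form with
  coefficients \<open>c\<close>, \<open>d\<close>, since otherwise the two would agree with
  \<open>g\<close> at \<open>n1\<close>. Wherever both forms and their difference are nonzero,
  \<open>g\<close> follows its own form and so misses the other.\<close>

lemma disagreement_spreads:
  fixes p N s :: int
  assumes p: "prime p" "p > 3" and g: "describes p N g a b"
    and n1: "n1 \<in> {0..<N}" "\<not> p dvd c * n1 + d" "\<not> [g n1 = c * n1 + d] (mod p)"
    and s: "0 \<le> s" "s + 3 < N"
  shows "\<exists>n\<in>{s..s + 3}. \<not> p dvd c * n + d \<and> \<not> [g n = c * n + d] (mod p)"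
proof -
  have ab: "\<not> (p dvd a \<and> p dvd b)"
    and rule: "\<And>n. n \<in> {0..<N} \<Longrightarrow> \<not> p dvd a * n + b \<Longrightarrow> [g n = a * n + b] (mod p)"
    using g unfolding describes_def by auto
  have cd: "\<not> (p dvd c \<and> p dvd d)"
    using n1(2) by auto
  have diff: "\<not> (p dvd a - c \<and> p dvd b - d)"
  proof
    assume "p dvd a - c \<and> p dvd b - d"
    then have "p dvd (a - c) * n1 + (b - d)"
      by simp
    then have "[a * n1 + b = c * n1 + d] (mod p)"
      by (simp add: cong_iff_dvd_diff algebra_simps)
    with rule[OF n1(1)] n1(2,3) show False
      by (meson cong_dvd_iff cong_trans)
  qed
  obtain n where n: "n \<in> {s..s + 3}" "\<not> p dvd a * n + b" "\<not> p dvd c * n + d"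
    "\<not> p dvd (a - c) * n + (b - d)"
    using three_affine_forms_nonzero[OF p ab cd diff] by blast
  have "[g n = a * n + b] (mod p)"
    using rule n s by simp
  moreover have "\<not> [a * n + b = c * n + d] (mod p)"
    using n(4) by (simp add: cong_iff_dvd_diff algebra_simps)
  ultimately show ?thesis
    using n by (meson cong_sym cong_trans)
qed

section \<open>Counting argument for a position without vanishing incidences\<close>

text \<open>Each incidence in \<open>T\<close> spoils at most one position per line of its slope in
  a window of width \<open>p\<close>. With fewer than \<open>p\<close> incidences and a window tall
  enough to absorb boundary effects, the spoiled positions cannot fill the window.\<close>

lemma generic_position:
  fixes p :: int and a b :: "int \<Rightarrow> int \<Rightarrow> int" and T :: "(int \<times> int \<times> int) set"
  assumes p: "prime p" and ab: "\<And>j i. \<not> (p dvd a j i \<and> p dvd b j i)"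
    and T: "finite T" "int (card T) < p"
  shows "\<exists>n m. 0 \<le> n \<and> n < p \<and> (\<forall>(x, y, j)\<in>T.
    \<not> p dvd a j (m + y - j * (n + x)) * (n + x) + b j (m + y - j * (n + x)))"
proof (rule ccontr)
  assume H: "\<not> ?thesis"
  have p1: "p > 1"
    using p prime_gt_1_int by blast
  define J where "J = (\<Sum>(x, y, j)\<in>T. \<bar>j\<bar>)"
  have J: "\<bar>j\<bar> \<le> J" if "(x, y, j) \<in> T" for x y j
    unfolding J_def using member_le_sum[OF that, of "\<lambda>(x, y, j). \<bar>j\<bar>"] T(1) by auto
  have "J \<ge> 0"
    unfolding J_def by (auto intro: sum_nonneg)
  \<comment> \<open>The height is chosen so that \<open>(p - 1) * (W + 2 * J * p + 1)\<close> is
    less than \<open>p * (W + 1)\<close>; the term \<open>2 * J * p\<close> bounds the extra lines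
    that enter the window through its sides.\<close>
  define W where "W = p * (2 * J * p)"
  have "W \<ge> 0"
    unfolding W_def using \<open>J \<ge> 0\<close> p1 by simp
  define B where "B = (\<lambda>(x, y, j). {(n, m). n \<in> {0..<p} \<and> m \<in> {0..W} \<and>
    p dvd a j (m + y - j * (n + x)) * (n + x) + b j (m + y - j * (n + x))})"
  have card: "card (B t) \<le> nat (W + 2 * J * p + 1)" if "t \<in> T" for t
  proof -
    obtain x y j where t: "t = (x, y, j)"
      by (metis surj_pair)
    \<comment> \<open>Two spoiled positions with equal \<open>m - j * n\<close> have their
      translates on one line of slope \<open>j\<close>, at abscissae less than \<open>p\<close>
      apart.\<close>
    have "inj_on (\<lambda>(n, m). m - j * n) (B t)"
    proof (rule inj_onI, clarify)
      fix n m n' m'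
      assume *: "(n, m) \<in> B t" "(n', m') \<in> B t" "m - j * n = m' - j * n'"
      define i where "i = m + y - j * (n + x)"
      have i': "m' + y - j * (n' + x) = i"
        using *(3) unfolding i_def by (simp add: algebra_simps)
      have "n + x = n' + x"
        by (rule affine_zero_unique[OF p ab, of j i])
          (use * i' in \<open>auto simp: B_def t i_def\<close>)
      with *(3) show "n = n' \<and> m = m'" by simp
    qed
    moreover have "(\<lambda>(n, m). m - j * n) ` B t \<subseteq> {- (J * p)..W + J * p}"
    proof clarify
      fix n m assume "(n, m) \<in> B t"
      then have nm: "0 \<le> n" "n < p" "0 \<le> m" "m \<le> W"
        by (auto simp: B_def t)
      have "\<bar>j * n\<bar> \<le> J * p"
        unfolding abs_mult using J[of x y j] that nm t \<open>J \<ge> 0\<close>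
        by (intro mult_mono) auto
      with nm show "m - j * n \<in> {- (J * p)..W + J * p}"
        by (auto simp: abs_le_iff)
    qed
    ultimately have "card (B t) \<le> card {- (J * p)..W + J * p}"
      by (metis card_inj_on_le finite_atLeastAtMost_int)
    then show ?thesis
      by (simp add: algebra_simps)
  qed
  have "{0..<p} \<times> {0..W} \<subseteq> (\<Union>t\<in>T. B t)"
    using H unfolding B_def by fastforce
  moreover have "finite (\<Union>t\<in>T. B t)"
  proof -
    have "(\<Union>t\<in>T. B t) \<subseteq> {0..<p} \<times> {0..W}"
      unfolding B_def by auto
    then show ?thesis
      by (rule finite_subset) simp
  qed
  ultimately have "card ({0..<p} \<times> {0..W}) \<le> card (\<Union>t\<in>T. B t)"
    by (intro card_mono)
  also have "\<dots> \<le> (\<Sum>t\<in>T. card (B t))"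
    using T(1) by (rule card_UN_le)
  also have "\<dots> \<le> card T * nat (W + 2 * J * p + 1)"
    using sum_bounded_above[of T "\<lambda>t. card (B t)"] card by simp
  finally have "nat p * nat (W + 1) \<le> card T * nat (W + 2 * J * p + 1)"
    by (simp add: card_cartesian_product)
  then have "int (nat p) * int (nat (W + 1)) \<le> int (card T) * int (nat (W + 2 * J * p + 1))"
    by (simp only: of_nat_mult[symmetric] of_nat_le_iff)
  moreover have "0 \<le> W + 2 * J * p + 1"
    using p1 \<open>W \<ge> 0\<close> \<open>J \<ge> 0\<close> by simp
  ultimately have "p * (W + 1) \<le> int (card T) * (W + 2 * J * p + 1)"
    using p1 \<open>W \<ge> 0\<close> by (simp del: of_nat_mult)
  also have "\<dots> \<le> (p - 1) * (W + 2 * J * p + 1)"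
    using T(2) p1 \<open>W \<ge> 0\<close> \<open>J \<ge> 0\<close> by (intro mult_right_mono) auto
  also have "\<dots> = p * (W + 1) - 1 - 2 * J * p"
    unfolding W_def by (simp add: algebra_simps)
  finally have "2 * J * p + 1 \<le> 0"
    by linarith
  moreover have "2 * J * p \<ge> 0"
    using \<open>J \<ge> 0\<close> p1 by simp
  ultimately show False
    by linarith
qed

section \<open>Gluing four consecutive rows\<close>

text \<open>Affine forms have zero second differences. The step \<open>h\<close> is 1 when reading
  along diagonals and -1 along the antidiagonal.\<close>

lemma second_difference:
  fixes p a b c d x :: int
  assumes "p dvd u - (c * x + d)" "p dvd v - (c * (x + h) + d)" "p dvd w - (c * (x + 2 * h) + d)"
  shows "p dvd u - 2 * v + w"
proof -
  have "u - 2 * v + w =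
      (u - (c * x + d)) - 2 * (v - (c * (x + h) + d)) + (w - (c * (x + 2 * h) + d))"
    by (simp add: algebra_simps)
  then show ?thesis
    using assms by (metis dvd_add dvd_diff dvd_mult)
qed

text \<open>
  Two parallel diagonals through the four rows make the form of row \<open>k\<close> affine in \<open>k\<close>, up to a
  bilinear term that a single antidiagonal removes.
\<close>

lemma four_rows_affine:
  fixes p n :: int and a b c d :: "int \<Rightarrow> int"
  assumes p: "prime p" "p > 2"
    and diag: "\<And>k y. k \<in> {0..3} \<Longrightarrow> y \<in> {0..1} \<Longrightarrow>
      p dvd (a k * (n + y + k) + b k) - (c y * (n + y + k) + d y)"
    and anti: "\<And>k. k \<in> {0..2} \<Longrightarrow> p dvd (a k * (n + 2 - k) + b k) - (e * (n + 2 - k) + f)"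
  shows "\<exists>B. \<forall>k\<in>{0..3}. \<forall>x. p dvd (a k * x + b k) - (a 0 * x + B * k + b 0)"
proof -
  \<comment> \<open>\<open>u k\<close> and \<open>v k\<close> are the values of the form of row
    \<open>k\<close> on the two neighbouring diagonals, so their difference is the slope
    \<open>a k\<close>.\<close>
  define u where "u k = a k * (n + k) + b k" for k
  define v where "v k = a k * (n + 1 + k) + b k" for k
  have a: "a k = v k - u k" for k
    unfolding u_def v_def by (simp add: algebra_simps)
  have half: "p dvd z" if "p dvd 2 * z" for z
    using that p prime_dvd_mult_iff[of p 2 z] by (auto dest: zdvd_imp_le)
  have u: "p dvd u k - 2 * u (k + 1) + u (k + 2)" if "k \<in> {0..1}" for k
    by (rule second_difference[of p _ "c 0" "n + k" "d 0" _ 1])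
      (use diag[of k 0] diag[of "k + 1" 0] diag[of "k + 2" 0] that in \<open>auto simp: u_def algebra_simps\<close>)
  have v: "p dvd v k - 2 * v (k + 1) + v (k + 2)" if "k \<in> {0..1}" for k
    by (rule second_difference[of p _ "c 1" "n + 1 + k" "d 1" _ 1])
      (use diag[of k 1] diag[of "k + 1" 1] diag[of "k + 2" 1] that in \<open>auto simp: v_def algebra_simps\<close>)
  have av: "p dvd a k - 2 * a (k + 1) + a (k + 2)" if "k \<in> {0..1}" for k
    using dvd_diff[OF v[OF that] u[OF that]] unfolding a by (simp add: algebra_simps)
  \<comment> \<open>The antidiagonal and the first diagonal cross in row 1 at abscissa
    \<open>n + 1\<close>, so \<open>u 1\<close> occurs in both relations and cancels; what is left
    compares \<open>a 0\<close> with \<open>a 2\<close>.\<close>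
  have "p dvd (a 0 * (n + 2) + b 0) - 2 * u 1 + (a 2 * n + b 2)"
    by (rule second_difference[of p _ e "n + 2" f _ "-1"])
      (use anti[of 0] anti[of 1] anti[of 2] in \<open>auto simp: u_def algebra_simps\<close>)
  from dvd_diff[OF this u[of 0]] have "p dvd 2 * (a 0 - a 2)"
    by (simp add: u_def algebra_simps)
  then have a2: "p dvd a 2 - a 0"
    using half dvd_diff_commute by blast
  have "p dvd 2 * (a 1 - a 0)"
    using dvd_diff[OF a2 av[of 0]] by (simp add: algebra_simps)
  then have a1: "p dvd a 1 - a 0"
    by (rule half)
  have "p dvd a 3 - a 0"
    using dvd_diff[OF dvd_add[OF av[of 1] dvd_mult[OF a2, of 2]] a1] by (simp add: algebra_simps)
  with a1 a2 have ak: "p dvd a k - a 0" if "k \<in> {0..3}" for k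
  proof -
    have "k = 0 \<or> k = 1 \<or> k = 2 \<or> k = 3"
      using that unfolding atLeastAtMost_iff by presburger
    then show ?thesis
      using a1 a2 \<open>p dvd a 3 - a 0\<close> by auto
  qed
  have u2: "p dvd u 2 - (u 0 + 2 * (u 1 - u 0))"
    using u[of 0] by (simp add: algebra_simps)
  have "p dvd u 3 - (u 0 + 3 * (u 1 - u 0))"
    using dvd_add[OF u[of 1] dvd_mult[OF u[of 0], of 2]] by (simp add: algebra_simps)
  with u2 have uk: "p dvd u k - (u 0 + k * (u 1 - u 0))" if "k \<in> {0..3}" for k
  proof -
    have "k = 0 \<or> k = 1 \<or> k = 2 \<or> k = 3"
      using that unfolding atLeastAtMost_iff by presburger
    then show ?thesis
      using u2 \<open>p dvd u 3 - (u 0 + 3 * (u 1 - u 0))\<close> by auto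
  qed
  \<comment> \<open>A step along the diagonal raises both coordinates by 1 and changes the common
    form by \<open>a 0 + B\<close>; this increment is \<open>u 1 - u 0\<close>.\<close>
  define B where "B = u 1 - u 0 - a 0"
  have "p dvd (a k * x + b k) - (a 0 * x + B * k + b 0)" if "k \<in> {0..3}" for k x
  proof -
    have "(a k * x + b k) - (a 0 * x + B * k + b 0) =
        (u k - (u 0 + k * (u 1 - u 0))) + (a k - a 0) * (x - n - k)"
      unfolding B_def u_def by (simp add: algebra_simps)
    then show ?thesis
      using uk[OF that] ak[OF that] by simp
  qed
  then show ?thesis by blast
qed

section \<open>From four rows to the whole board\<close>

text \<open>Ordinary induction in both directions on the start of a window of four consecutive
  integers satisfying \<open>P\<close>.\<close>

lemma int_induct_four:
  fixes P :: "int \<Rightarrow> bool"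
  assumes base: "\<And>k. k \<in> {0..3} \<Longrightarrow> P (m0 + k)"
    and up: "\<And>m. (\<And>t. t \<in> {1..4} \<Longrightarrow> P (m - t)) \<Longrightarrow> P m"
    and down: "\<And>m. (\<And>t. t \<in> {1..4} \<Longrightarrow> P (m + t)) \<Longrightarrow> P m"
  shows "P m"
proof -
  have "\<forall>k\<in>{0..3}. P (m + k)"
  proof (induction m rule: int_induct[of _ m0])
    case base
    then show ?case using assms(1) by blast
  next
    case (step1 i)
    have "P (i + 4)"
    proof (rule up)
      fix t :: int assume "t \<in> {1..4}"
      then show "P (i + 4 - t)"
        using step1(2)[rule_format, of "4 - t"] by (simp add: algebra_simps)
    qed
    moreover have "P (i + 1 + k)" if "k \<in> {0..2}" for k
      using step1(2)[rule_format, of "k + 1"] that by (simp add: algebra_simps)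
    ultimately have "P (i + 1 + k)" if "k \<in> {0..3}" for k
      using that by (cases "k = 3") (auto simp: add.commute)
    then show ?case by blast
  next
    case (step2 i)
    have "P (i - 1)"
    proof (rule down)
      fix t :: int assume "t \<in> {1..4}"
      then show "P (i - 1 + t)"
        using step2(2)[rule_format, of "t - 1"] by (simp add: algebra_simps)
    qed
    moreover have "P (i - 1 + k)" if "k \<in> {1..3}" for k
      using step2(2)[rule_format, of "k - 1"] that by (simp add: algebra_simps)
    ultimately have "P (i - 1 + k)" if "k \<in> {0..3}" for k
      using that by (cases "k = 0") auto
    then show ?case by blast
  qed
  then show ?thesis
    by (metis add_0_right atLeastAtMost_iff order_refl zero_le_numeral)
qed

lemma line_value:
  assumes lines: "\<And>j i. describes p N (\<lambda>n. F (n, j * n + i)) (a j i) (b j i)"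
    and "n \<in> {0..<N}" "\<not> p dvd a j (m - j * n) * n + b j (m - j * n)"
  shows "[F (n, m) = a j (m - j * n) * n + b j (m - j * n)] (mod p)"
proof -
  have "\<forall>n'\<in>{0..<N}. \<not> p dvd a j (m - j * n) * n' + b j (m - j * n) \<longrightarrow>
      [F (n', j * n' + (m - j * n)) = a j (m - j * n) * n' + b j (m - j * n)] (mod p)"
    using lines[of j "m - j * n"] unfolding describes_def by blast
  from this[rule_format, OF assms(2,3)] show ?thesis by simp
qed

lemma four_rows:
  fixes p N :: int and F :: "int \<times> int \<Rightarrow> int" and a b :: "int \<Rightarrow> int \<Rightarrow> int"
  assumes p: "prime p" "p > 21" and N: "N \<ge> p + 4"
    and lines: "\<And>j i. describes p N (\<lambda>n. F (n, j * n + i)) (a j i) (b j i)"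
  shows "\<exists>A B C m0. \<not> (p dvd A \<and> p dvd B \<and> p dvd C) \<and>
    (\<forall>k\<in>{0..3}. \<forall>x. p dvd (a 0 (m0 + k) * x + b 0 (m0 + k)) - (A * x + B * (m0 + k) + C))"
proof -
  \<comment> \<open>An entry \<open>(x, y, j)\<close> is the point \<open>(n + x, m + y)\<close> on
    its line of slope \<open>j\<close>. The first 16 entries put the points
    \<open>(y + k, k)\<close> of two diagonals on their rows and on their diagonals; the last five
    complete the antidiagonal \<open>(2 - k, k)\<close>, whose middle point already has its row
    entry.\<close>
  define T :: "(int \<times> int \<times> int) set" where
    "T = set [(0, 0, 0), (1, 1, 0), (2, 2, 0), (3, 3, 0), (1, 0, 0), (2, 1, 0), (3, 2, 0),
      (4, 3, 0), (0, 0, 1), (1, 1, 1), (2, 2, 1), (3, 3, 1), (1, 0, 1), (2, 1, 1), (3, 2, 1),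
      (4, 3, 1), (2, 0, 0), (0, 2, 0), (2, 0, - 1), (1, 1, - 1), (0, 2, - 1)]"
  have "finite T"
    unfolding T_def by (rule finite_set)
  moreover have "card T \<le> 21"
    unfolding T_def by (rule card_length[THEN order_trans]) simp
  then have "int (card T) < p"
    using p(2) by linarith
  ultimately have "\<exists>n m. 0 \<le> n \<and> n < p \<and> (\<forall>(x, y, j)\<in>T.
      \<not> p dvd a j (m + y - j * (n + x)) * (n + x) + b j (m + y - j * (n + x)))"
    using lines unfolding describes_def by (intro generic_position p(1)) blast+
  then obtain n m where nm: "0 \<le> n" "n < p"
    "\<And>x y j. (x, y, j) \<in> T \<Longrightarrow>
      \<not> p dvd a j (m + y - j * (n + x)) * (n + x) + b j (m + y - j * (n + x))"
    by fast
  have val: "[F (n + x, m + y) =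
      a j (m + y - j * (n + x)) * (n + x) + b j (m + y - j * (n + x))] (mod p)"
    if "(x, y, j) \<in> T" for x y j
  proof (rule line_value[OF lines])
    \<comment> \<open>With \<open>n < p\<close>, the bound 4 keeps every point of the pattern inside
      the board, whose width is at least \<open>p + 4\<close>.\<close>
    have "0 \<le> x \<and> x \<le> 4"
      using that unfolding T_def by auto
    then show "n + x \<in> {0..<N}"
      using nm(1,2) N by simp
  qed (use nm(3)[OF that] in simp)
  define r where "r k = a 0 (m + k)" for k
  define s where "s k = b 0 (m + k)" for k
  have diag: "p dvd (r k * (n + y + k) + s k)
      - (a 1 (m - n - y) * (n + y + k) + b 1 (m - n - y))"
    if "k \<in> {0..3}" "y \<in> {0..1}" for k y
  proof -
    have "(k = 0 \<or> k = 1 \<or> k = 2 \<or> k = 3) \<and> (y = 0 \<or> y = 1)"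
      using that unfolding atLeastAtMost_iff by presburger
    then have "(y + k, k, 0) \<in> T \<and> (y + k, k, 1) \<in> T"
      by (elim conjE disjE) (simp_all add: T_def)
    from cong_trans[OF cong_sym[OF val[OF this[THEN conjunct1]]] val[OF this[THEN conjunct2]]] show ?thesis
      unfolding r_def s_def cong_iff_dvd_diff by (simp add: algebra_simps)
  qed
  have anti: "p dvd (r k * (n + 2 - k) + s k)
      - (a (- 1) (m + n + 2) * (n + 2 - k) + b (- 1) (m + n + 2))"
    if "k \<in> {0..2}" for k
  proof -
    have "k = 0 \<or> k = 1 \<or> k = 2"
      using that unfolding atLeastAtMost_iff by presburger
    then have "(2 - k, k, 0) \<in> T \<and> (2 - k, k, - 1) \<in> T"
      by (elim disjE) (simp_all add: T_def)
    from cong_trans[OF cong_sym[OF val[OF this[THEN conjunct1]]] val[OF this[THEN conjunct2]]] show ?thesis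
      unfolding r_def s_def cong_iff_dvd_diff by (simp add: algebra_simps)
  qed
  have "\<exists>B. \<forall>k\<in>{0..3}. \<forall>x. p dvd (r k * x + s k) - (r 0 * x + B * k + s 0)"
    by (rule four_rows_affine[OF p(1) _ diag anti]) (use p(2) in simp)
  then obtain B where B: "\<And>k x. k \<in> {0..3} \<Longrightarrow>
      p dvd (r k * x + s k) - (r 0 * x + B * k + s 0)"
    by blast
  \<comment> \<open>If all three vanished modulo \<open>p\<close>, so would both coefficients of the
    form of row \<open>m\<close>.\<close>
  have "\<not> (p dvd r 0 \<and> p dvd B \<and> p dvd s 0 - B * m)"
  proof
    assume *: "p dvd r 0 \<and> p dvd B \<and> p dvd s 0 - B * m"
    then have "p dvd (s 0 - B * m) + B * m"
      by (intro dvd_add) auto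
    with * show False
      using lines[of 0 m] unfolding describes_def r_def s_def by simp
  qed
  moreover have "p dvd (a 0 (m + k) * x + b 0 (m + k)) - (r 0 * x + B * (m + k) + (s 0 - B * m))"
    if "k \<in> {0..3}" for k x
    using B[OF that, of x] unfolding r_def s_def by (simp add: algebra_simps)
  ultimately show ?thesis
    by blast
qed

lemma affine_form_exists:
  fixes p N :: int and F :: "int \<times> int \<Rightarrow> int" and a b :: "int \<Rightarrow> int \<Rightarrow> int"
  assumes p: "prime p" "p > 21" and N: "N \<ge> p + 4"
    and lines: "\<And>j i. describes p N (\<lambda>n. F (n, j * n + i)) (a j i) (b j i)"
  shows "\<exists>A B C. \<not> (p dvd A \<and> p dvd B \<and> p dvd C) \<and>
    (\<forall>n\<in>{0..<N}. \<forall>m. \<not> p dvd A * n + B * m + C \<longrightarrow> [F (n, m) = A * n + B * m + C] (mod p))"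
proof -
  obtain A B C m0 where ABC: "\<not> (p dvd A \<and> p dvd B \<and> p dvd C)"
    and rows: "\<And>k x. k \<in> {0..3} \<Longrightarrow>
      p dvd (a 0 (m0 + k) * x + b 0 (m0 + k)) - (A * x + B * (m0 + k) + C)"
    using four_rows[OF assms] by blast
  define L where "L n m = A * n + B * m + C" for n m
  define bad where "bad n m \<longleftrightarrow> \<not> p dvd L n m \<and> \<not> [F (n, m) = L n m] (mod p)" for n m
  have spread: "\<exists>n'\<in>{s..s + 3}. bad n' (m + j * (n' - n))"
    if "n \<in> {0..<N}" "bad n m" "0 \<le> s" "s + 3 < N" for n m j s
  proof -
    \<comment> \<open>Restricting \<open>L\<close> to the line of slope \<open>j\<close> through
      \<open>(n, m)\<close> gives an affine form in the abscissa.\<close>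
    have eq: "(A + B * j) * x + (B * (m - j * n) + C) = L x (m + j * (x - n))"
      "j * x + (m - j * n) = m + j * (x - n)" for x
      unfolding L_def by (simp_all add: algebra_simps)
    show ?thesis
      using disagreement_spreads[OF p(1) _ lines[of j "m - j * n"] that(1) _ _ that(3,4),
          of "A + B * j" "B * (m - j * n) + C"] p(2) that(2)
      unfolding eq bad_def by simp
  qed
  define ok where "ok m \<longleftrightarrow> (\<forall>n\<in>{0..<N}. \<not> bad n m)" for m
  have "ok m" for m
  proof (rule int_induct_four[of ok])
    fix k :: int assume k: "k \<in> {0..3}"
    show "ok (m0 + k)"
      unfolding ok_def bad_def
    proof (intro ballI notI, elim conjE)
      fix n assume n: "n \<in> {0..<N}" "\<not> p dvd L n (m0 + k)" "\<not> [F (n, m0 + k) = L n (m0 + k)] (mod p)"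
      have *: "[a 0 (m0 + k) * n + b 0 (m0 + k) = L n (m0 + k)] (mod p)"
        using rows[OF k] unfolding L_def cong_iff_dvd_diff .
      with n(2) have "\<not> p dvd a 0 (m0 + k) * n + b 0 (m0 + k)"
        using cong_dvd_iff by blast
      with line_value[OF lines, of n 0 "m0 + k"] n(1) * n(3) show False
        using cong_trans by auto
    qed
  next
    fix m :: int assume below: "\<And>t. t \<in> {1..4} \<Longrightarrow> ok (m - t)"
    show "ok m"
      unfolding ok_def
    proof (intro ballI notI)
      fix n assume "n \<in> {0..<N}" "bad n m"
      \<comment> \<open>The window starts at 4 to leave four columns on the left: the diagonal of
        slope 1 there runs through the rows \<open>m - 4\<close> to \<open>m - 1\<close>, already
        known to be good.\<close>
      then obtain n1 where n1: "n1 \<in> {4..7}" "bad n1 m"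
        using spread[of n m 4 0] N p(2) by auto
      then obtain n2 where n2: "n2 \<in> {n1 - 4..n1 - 1}" "bad n2 (m + (n2 - n1))"
        using spread[of n1 m "n1 - 4" 1] N p(2) by auto
      have "m - (n1 - n2) = m + (n2 - n1)"
        by simp
      moreover have "ok (m - (n1 - n2))"
        using n2(1) by (intro below) auto
      ultimately have "ok (m + (n2 - n1))"
        by metis
      moreover have "n2 \<in> {0..<N}"
        using n1(1) n2(1) N p(2) by auto
      ultimately show False
        using n2(2) unfolding ok_def by blast
    qed
  next
    fix m :: int assume above: "\<And>t. t \<in> {1..4} \<Longrightarrow> ok (m + t)"
    show "ok m"
      unfolding ok_def
    proof (intro ballI notI)
      fix n assume "n \<in> {0..<N}" "bad n m"
      \<comment> \<open>Mirror image: the diagonal is followed to the right, through the rows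
        \<open>m + 1\<close> to \<open>m + 4\<close>.\<close>
      then obtain n1 where n1: "n1 \<in> {0..3}" "bad n1 m"
        using spread[of n m 0 0] N p(2) by auto
      then obtain n2 where n2: "n2 \<in> {n1 + 1..n1 + 1 + 3}" "bad n2 (m + (n2 - n1))"
        using spread[of n1 m "n1 + 1" 1] N p(2) by auto
      have "ok (m + (n2 - n1))"
        using n2(1) by (intro above) auto
      moreover have "n2 \<in> {0..<N}"
        using n1(1) n2(1) N p(2) by auto
      ultimately show False
        using n2(2) unfolding ok_def by blast
    qed
  qed
  then show ?thesis
    using ABC unfolding ok_def bad_def L_def by blast
qed

section \<open>Uniqueness of the coefficients and the column criterion\<close>

lemma valuation_eq_0_iff:
  fixes p x :: int
  assumes "prime p"
  shows "valuation p x = 0 \<longleftrightarrow> \<not> p dvd x"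
proof -
  have "multiplicity p x = 0 \<longleftrightarrow> \<not> p dvd x" if "x \<noteq> 0"
    using assms that by (meson multiplicity_eq_zero_iff not_prime_unit)
  then show ?thesis
    by (auto simp: valuation_def zero_enat_def)
qed

lemma affine_description_cong:
  assumes "prime p" "affine_description p N F A B C" "n \<in> {0..<N}" "\<not> p dvd A * n + B * m + C"
  shows "F (n, m) = (A * n + B * m + C) mod p"
proof -
  have "(n, m) \<in> board N"
    using assms(3) by (simp add: board_def)
  with assms(2,4) show ?thesis
    unfolding affine_description_def reduction_def valuation_eq_0_iff[OF assms(1)] by blast
qed

text \<open>At a point where both forms and their difference are nonzero, \<open>F\<close> would
  take two values. Such a point is found by choosing first a row on which none of the three forms is
  trivial, then a column.\<close>

lemma affine_description_unique:
  assumes p: "prime p" "p > 3" and N: "N > 3"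
    and D: "affine_description p N F A B C" "affine_description p N F A' B' C'"
  shows "[A = A'] (mod p) \<and> [B = B'] (mod p) \<and> [C = C'] (mod p)"
proof (rule ccontr)
  assume "\<not> ?thesis"
  then have nontrivial: "\<not> (p dvd A \<and> p dvd B \<and> p dvd C)" "\<not> (p dvd A' \<and> p dvd B' \<and> p dvd C')"
    "\<not> (p dvd A - A' \<and> p dvd B - B' \<and> p dvd C - C')"
    using D by (auto simp: affine_description_def cong_iff_dvd_diff)
  \<comment> \<open>\<open>U X Y * m + V X Z\<close> encodes nontriviality of
    \<open>X * n + (Y * m + Z)\<close> in \<open>n\<close>: if \<open>p\<close> divides
    \<open>X\<close> it is the constant term \<open>Y * m + Z\<close>, otherwise the constant
    1.\<close>
  define U where "U X Y = (if p dvd X then Y else 0)" for X Y :: int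
  define V where "V X Z = (if p dvd X then Z else 1)" for X Z :: int
  have UV: "\<not> (p dvd U X Y \<and> p dvd V X Z)" if "\<not> (p dvd X \<and> p dvd Y \<and> p dvd Z)" for X Y Z
    using that p by (auto simp: U_def V_def)
  have row: "\<not> (p dvd X \<and> p dvd Y * m + Z)" if "\<not> p dvd U X Y * m + V X Z" for X Y Z m
    using that by (auto simp: U_def V_def)
  obtain m where m: "\<not> p dvd U A B * m + V A C" "\<not> p dvd U A' B' * m + V A' C'"
    "\<not> p dvd U (A - A') (B - B') * m + V (A - A') (C - C')"
    using three_affine_forms_nonzero[OF p nontrivial[THEN UV]] by blast
  obtain n where n: "n \<in> {0..0 + 3}" "\<not> p dvd A * n + (B * m + C)"
    "\<not> p dvd A' * n + (B' * m + C')" "\<not> p dvd (A - A') * n + ((B - B') * m + (C - C'))"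
    using three_affine_forms_nonzero[OF p m[THEN row]] by blast
  have "[A * n + B * m + C = A' * n + B' * m + C'] (mod p)"
    using affine_description_cong[OF p(1) D(1), of n m] affine_description_cong[OF p(1) D(2), of n m]
      n N by (simp add: cong_def algebra_simps)
  with n(4) show False
    by (simp add: cong_iff_dvd_diff algebra_simps)
qed

text \<open>If \<open>p\<close> divides \<open>B\<close>, the form is constant modulo
  \<open>p\<close> on each column, and some column has a nonzero value. If not, \<open>B\<close> is
  invertible modulo \<open>p\<close> and every column attains all nonzero residues.\<close>

lemma nonconstant_columns_iff:
  assumes p: "prime p" "p > 3" and N: "N > 3" and D: "affine_description p N F A B C"
  shows "nonconstant_columns N F \<longleftrightarrow> \<not> p dvd B"
proof
  assume F: "nonconstant_columns N F"
  show "\<not> p dvd B"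
  proof
    assume B: "p dvd B"
    then have "\<not> (p dvd A \<and> p dvd C)"
      using D by (auto simp: affine_description_def)
    from three_affine_forms_nonzero[OF p this this this, of 0]
    obtain n where "n \<in> {0..0 + 3}" "\<not> p dvd A * n + C"
      by blast
    with N have n: "n \<in> {0..<N}" "\<not> p dvd A * n + C"
      by auto
    have shift: "[A * n + B * m + C = A * n + C] (mod p)" for m
      using B by (simp add: cong_iff_dvd_diff)
    then have "F (n, m) = (A * n + C) mod p" for m
      using affine_description_cong[OF p(1) D n(1), of m] n(2) cong_dvd_iff[OF shift]
      by (simp add: cong_def)
    with F n(1) show False
      unfolding nonconstant_columns_def by blast
  qed
next
  assume "\<not> p dvd B"
  then have "coprime B p"
    using p(1) prime_imp_coprime coprime_commute by blast
  then obtain x where x: "[B * x = 1] (mod p)"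
    using cong_solve_coprime_int by blast
  have attains: "\<exists>m. F (n, m) = r" if n: "n \<in> {0..<N}" and r: "0 < r" "r < p" for n r
  proof
    define m where "m = x * (r - A * n - C)"
    have "[B * x * (r - A * n - C) = 1 * (r - A * n - C)] (mod p)"
      using x by (rule cong_mult) simp
    then have L: "[A * n + B * m + C = r] (mod p)"
      unfolding m_def by (simp add: cong_iff_dvd_diff algebra_simps)
    have "\<not> p dvd r"
      using r zdvd_not_zless by blast
    then have "F (n, m) = (A * n + B * m + C) mod p"
      using affine_description_cong[OF p(1) D n] cong_dvd_iff[OF L] by blast
    with L r show "F (n, m) = r"
      by (simp add: cong_def)
  qed
  show "nonconstant_columns N F"
    unfolding nonconstant_columns_def
  proof (intro ballI notI, elim exE)
    fix n c assume n: "n \<in> {0..<N}" and c: "\<forall>m. F (n, m) = c"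
    \<comment> \<open>Since \<open>p > 3\<close>, both 1 and 2 are nonzero residues, and they are
      distinct.\<close>
    with attains[OF n, of 1] attains[OF n, of 2] p(2) show False
      by auto
  qed
qed

theorem theorem4p7:
  fixes p N :: int and F :: "int \<times> int \<Rightarrow> int"
  assumes "prime p" and "p > 48"
    and "N > 0" and "p ^ 2 dvd N"
    and "sudoku_solution p N F"
  shows "(\<exists>A B C. affine_description p N F A B C) \<and>
    (\<forall>A B C A' B' C'. affine_description p N F A B C \<longrightarrow> affine_description p N F A' B' C' \<longrightarrow>
      [A = A'] (mod p) \<and> [B = B'] (mod p) \<and> [C = C'] (mod p)) \<and>
    (\<forall>A B C. affine_description p N F A B C \<longrightarrow> (nonconstant_columns N F \<longleftrightarrow> \<not> p dvd B))"
proof -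
  have "p * p \<le> N"
    using assms(3,4) zdvd_imp_le by (simp add: power2_eq_square)
  moreover have "48 * p \<le> p * p"
    using assms(2) by (intro mult_right_mono) auto
  ultimately have N: "p + 4 \<le> N"
    using assms(2) by linarith
  \<comment> \<open>The values are canonical representatives, so the congruences obtained for
    \<open>F\<close> become equalities with \<open>reduction\<close>.\<close>
  have F: "F (n, m) mod p = F (n, m)" if "n \<in> {0..<N}" for n m
  proof -
    have "F (n, m) \<in> nonzero_residues p"
      using assms(5) that unfolding sudoku_solution_def board_def by auto
    then show ?thesis
      by (simp add: nonzero_residues_def residue_ring_def)
  qed
  have "\<forall>j i. \<exists>a b. describes p N (\<lambda>n. F (n, j * n + i)) a b"
    using assms(1,5) sudoku_rule_describes unfolding sudoku_solution_def by blast
  then obtain a b where ab: "\<And>j i. describes p N (\<lambda>n. F (n, j * n + i)) (a j i) (b j i)"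
    unfolding choice_iff by blast
  have "p > 21"
    using assms(2) by simp
  from affine_form_exists[OF assms(1) this N ab] obtain A B C where
    nontrivial: "\<not> (p dvd A \<and> p dvd B \<and> p dvd C)" and
    agree: "\<And>n m. n \<in> {0..<N} \<Longrightarrow> \<not> p dvd A * n + B * m + C \<Longrightarrow>
      [F (n, m) = A * n + B * m + C] (mod p)"
    by blast
  have "affine_description p N F A B C"
    unfolding affine_description_def valuation_eq_0_iff[OF assms(1)] board_def reduction_def
    using nontrivial agree F by (auto simp: cong_def)
  moreover have "p > 3" "N > 3"
    using assms(2) N by simp_all
  ultimately show ?thesis
    using affine_description_unique[OF assms(1)] nonconstant_columns_iff[OF assms(1)] by blast
qed

end
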